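(* Let $\theta_0\in(0,\pi)$ and suppose $\theta(e)=\theta_0$ for all $e\in E(\Gamma)$. Let $\alpha>0$ with $\alpha\theta_0\notin\pi\mathbb{Z}$. Then there exists a balanced homogeneous harmonic function $f:C(\Gamma,\theta)\to\mathbb{R}$ of degree $\alpha$ that is not identically zero if and only if $1-\cos(\alpha\theta_0)$ is an eigenvalue of the normalized graph Laplacian $\mathcal{L}$ of $\Gamma$.
   Context: $\Gamma$ is a finite connected simplicial graph (no loops or multiple edges) with at least one edge, vertex set $V(\Gamma)=\{v_i\}$ and edge set $E(\Gamma)$; $v\sim w$ means adjacent. $\theta:E(\Gamma)\to(0,\pi)$ is a function. $S_{\theta_0}=\{(r,\theta): r\ge 0,\ 0\le\theta\le\theta_0\}$ is the Euclidean plane sector in polar coordinates. The normalized graph Laplacian is the symmetric matrix $\mathcal{L}$ with $\mathcal{L}_{ii}=1$, $\mathcal{L}_{ij}=-1/\sqrt{\deg(v_i)\deg(v_j)}$ if $v_i\sim v_j$, and $\mathcal{L}_{ij}=0$ otherwise. The cone $C(\Gamma)=(\Gamma\times[0,\infty))/\!\sim$ collapses $\Gamma\times\{0\}$ to a point. $C(\Gamma,\theta)$ is $C(\Gamma)$ with the metric for which each face $C(e)$, $e\in E(\Gamma)$, is isometric to $S_{\theta(e)}$: identifying $e$ with $[0,1]$, $(x,t)\in C(e)$ corresponds to polar coordinates $(r,\theta)=(t,x\theta(e))$. If $v$ is an endpoint of $e$, the coordinates adapted to $v$ are those where $v$ corresponds to $0$, so that $C(v)=\{v\}\times[0,\infty)$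 is the ray $\theta=0$. A homogeneous function $f:C(\Gamma,\theta)\to\mathbb{R}$ of degree $\alpha>0$ has the form $f(x,t)=\rho(x)t^\alpha$ with $\rho:\Gamma\to\mathbb{R}$ continuous. It is harmonic if its restriction to each face $C(e)$, expressed in the polar coordinates $(r,\theta)=(t,x\theta(e))$ identifying $C(e)$ with $S_{\theta(e)}$, is harmonic in the interior of the plane sector $S_{\theta(e)}$. It is balanced if for every $v\in V(\Gamma)$, $\sum_j\frac{\partial u_j}{\partial\theta}(r,0)=0$ for all $r>0$, where $e_j$ runs over the edges incident to $v$ and $u_j$ is $f|_{C(e_j)}$ in coordinates adapted to $v$. *)

theory Defs
  imports
    "HOL-Analysis.Analysis"
    "Jordan_Normal_Form.Char_Poly"
begin

no_notation Matrix.scalar_prod (infix "\<bullet>" 70)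

section \<open>Finite simplicial graphs\<close>

definition finite_simple_graph :: "'v set \<Rightarrow> 'v set set \<Rightarrow> bool" where
  "finite_simple_graph V E \<longleftrightarrow> finite V \<and> (\<forall>e\<in>E. e \<subseteq> V \<and> card e = 2)"

definition connected_graph :: "'v set \<Rightarrow> 'v set set \<Rightarrow> bool" where
  "connected_graph V E \<longleftrightarrow> (\<forall>v\<in>V. \<forall>w\<in>V. (v, w) \<in> {(a, b). {a, b} \<in> E}\<^sup>*)"

definition vertex_degree :: "'v set set \<Rightarrow> 'v \<Rightarrow> nat" where
  "vertex_degree E v = card {e \<in> E. v \<in> e}"

definition normalized_laplacian :: "'v set set \<Rightarrow> 'v list \<Rightarrow> real Matrix.mat" where
  "normalized_laplacian E vs = Matrix.mat (length vs) (length vs) (\<lambda>(i, j).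
     if i = j then 1
     else if {vs ! i, vs ! j} \<in> E
       then - 1 / sqrt (real (vertex_degree E (vs ! i)) * real (vertex_degree E (vs ! j)))
     else 0)"

section \<open>The graph as a topological space, and its cone\<close>

text \<open>Points of the graph are given by their barycentric coordinates, so that the graph carries
  the subspace topology of the product topology on \<^typ>\<open>'v \<Rightarrow> real\<close>.\<close>

definition graph_space :: "'v set \<Rightarrow> 'v set set \<Rightarrow> ('v \<Rightarrow> real) set" where
  "graph_space V E = {p. (\<forall>v. 0 \<le> p v) \<and> (\<Sum>v\<in>V. p v) = 1 \<and>
     {v. p v \<noteq> 0} \<in> E \<union> (\<lambda>v. {v}) ` V}"

text \<open>The identification of an edge with endpoints \<open>v\<close>, \<open>w\<close> with the unit interval for which
  \<open>v\<close> corresponds to \<open>0\<close>.\<close>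

definition edge_point :: "'v \<Rightarrow> 'v \<Rightarrow> real \<Rightarrow> 'v \<Rightarrow> real" where
  "edge_point v w x = (\<lambda>_. 0)(v := 1 - x, w := x)"

definition cone_rel :: "'v set \<Rightarrow> 'v set set \<Rightarrow> (('v \<Rightarrow> real) \<times> real) rel" where
  "cone_rel V E = {((p, s), (q, t)). p \<in> graph_space V E \<and> q \<in> graph_space V E \<and>
     0 \<le> s \<and> 0 \<le> t \<and> (p = q \<and> s = t \<or> s = 0 \<and> t = 0)}"

definition graph_cone :: "'v set \<Rightarrow> 'v set set \<Rightarrow> (('v \<Rightarrow> real) \<times> real) set set" where
  "graph_cone V E = (graph_space V E \<times> {0..}) // cone_rel V E"

definition cone_point :: "'v set \<Rightarrow> 'v set set \<Rightarrow> ('v \<Rightarrow> real) \<Rightarrow> real \<Rightarrow> (('v \<Rightarrow> real) \<times> real) set" where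
  "cone_point V E p t = cone_rel V E `` {(p, t)}"

text \<open>Polar coordinates \<open>(r, \<phi>)\<close> on the face over the edge with endpoints \<open>v\<close>, \<open>w\<close>, adapted to
  \<open>v\<close>; they range over \<open>0 \<le> r\<close> and \<open>0 \<le> \<phi> \<le> \<theta> {v, w}\<close>. The cone metric enters harmonicity and
  balancing only through these coordinates.\<close>

definition face_polar ::
    "'v set \<Rightarrow> 'v set set \<Rightarrow> ('v set \<Rightarrow> real) \<Rightarrow> 'v \<Rightarrow> 'v \<Rightarrow> real \<Rightarrow> real \<Rightarrow> (('v \<Rightarrow> real) \<times> real) set" where
  "face_polar V E \<theta> v w r \<phi> = cone_point V E (edge_point v w (\<phi> / \<theta> {v, w})) r"

text \<open>The Euclidean plane is \<^typ>\<open>complex\<close>.\<close>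

definition sector :: "real \<Rightarrow> complex set" where
  "sector \<theta>\<^sub>0 = {rcis r \<phi> | r \<phi>. 0 \<le> r \<and> 0 \<le> \<phi> \<and> \<phi> \<le> \<theta>\<^sub>0}"

section \<open>Balanced homogeneous harmonic functions on the cone\<close>

text \<open>Twice continuously differentiable with vanishing Laplacian: \<open>g\<close> is the gradient and
  \<open>H x\<close> the Hessian at \<open>x\<close>, whose trace is the Laplacian.\<close>

definition harmonic_on :: "('a::euclidean_space \<Rightarrow> real) \<Rightarrow> 'a set \<Rightarrow> bool" where
  "harmonic_on u S \<longleftrightarrow> open S \<and> (\<exists>g H.
     (\<forall>x\<in>S. (u has_derivative (\<lambda>h. g x \<bullet> h)) (at x) \<and> (g has_derivative H x) (at x)) \<and>
     (\<forall>b\<in>Basis. continuous_on S (\<lambda>x. H x b)) \<and>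
     (\<forall>x\<in>S. (\<Sum>b\<in>Basis. H x b \<bullet> b) = 0))"

definition cone_homogeneous ::
    "'v set \<Rightarrow> 'v set set \<Rightarrow> real \<Rightarrow> ((('v \<Rightarrow> real) \<times> real) set \<Rightarrow> real) \<Rightarrow> bool" where
  "cone_homogeneous V E \<alpha> f \<longleftrightarrow> (\<exists>\<rho>. continuous_on (graph_space V E) \<rho> \<and>
     (\<forall>p\<in>graph_space V E. \<forall>t\<ge>0. f (cone_point V E p t) = \<rho> p * t powr \<alpha>))"

text \<open>Each face is tested in both of its sector coordinates; they differ by a reflection of the
  sector. As \<open>0 < \<theta> {v, w} < \<pi>\<close>, the principal argument is the angular coordinate on the sector.\<close>

definition cone_harmonic ::
    "'v set \<Rightarrow> 'v set set \<Rightarrow> ('v set \<Rightarrow> real) \<Rightarrow> ((('v \<Rightarrow> real) \<times> real) set \<Rightarrow> real) \<Rightarrow> bool" where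
  "cone_harmonic V E \<theta> f \<longleftrightarrow> (\<forall>v w. {v, w} \<in> E \<longrightarrow>
     harmonic_on (\<lambda>z. f (face_polar V E \<theta> v w (cmod z) (Arg z))) (interior (sector (\<theta> {v, w}))))"

text \<open>Edges incident to \<open>v\<close> are indexed by their other endpoint \<open>w\<close>. The angular derivative at
  \<open>0\<close> is one-sided, since the sector lies on one side of the ray over \<open>v\<close>.\<close>

definition cone_balanced ::
    "'v set \<Rightarrow> 'v set set \<Rightarrow> ('v set \<Rightarrow> real) \<Rightarrow> ((('v \<Rightarrow> real) \<times> real) set \<Rightarrow> real) \<Rightarrow> bool" where
  "cone_balanced V E \<theta> f \<longleftrightarrow> (\<forall>v\<in>V. \<forall>r>0. \<exists>D.
     (\<forall>w. {v, w} \<in> E \<longrightarrow>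
        ((\<lambda>\<phi>. f (face_polar V E \<theta> v w r \<phi>)) has_real_derivative D w) (at 0 within {0..\<theta> {v, w}})) \<and>
     (\<Sum>w | {v, w} \<in> E. D w) = 0)"

end

theory Submission
  imports Defs
begin

unbundle no vec_syntax

text \<open>For a homogeneous function \<open>f = \<rho> t\<^sup>\<alpha>\<close>, harmonicity on a face says that \<open>\<rho>\<close>, as a function of the angle,
  satisfies \<open>\<rho>'' = - \<alpha>\<^sup>2 \<rho>\<close>. As \<open>sin (\<alpha> \<theta>\<^sub>0) \<noteq> 0\<close>, such a \<open>\<rho>\<close> is determined on each edge by its
  boundary values \<open>h\<close>, which may be prescribed arbitrarily. The angular derivative at \<open>v\<close> along the
  edge towards \<open>w\<close> is proportional to \<open>h w - cos (\<alpha> \<theta>\<^sub>0) h v\<close>, so \<open>f\<close> is balanced iff the neighbours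
  of each \<open>v\<close> satisfy \<open>\<Sum> h w = deg v cos (\<alpha> \<theta>\<^sub>0) h v\<close>. Rescaling by \<open>\<surd>(deg v)\<close> turns this into the
  eigenvalue equation of the normalized Laplacian.\<close>

section \<open>Graphs and the normalized Laplacian\<close>

text \<open>As every edge has exactly two elements, sending a neighbour \<open>w\<close> to
  \<open>{v, w}\<close> is a bijection onto the edges at \<open>v\<close>. This links degrees to the
  sums over \<open>w\<close> in the balancing condition.\<close>

lemma vertex_degree_eq_card_neighbours:
  assumes "finite_simple_graph V E"
  shows "vertex_degree E v = card {w. {v, w} \<in> E}"
proof -
  have "{e \<in> E. v \<in> e} = (\<lambda>w. {v, w}) ` {w. {v, w} \<in> E}"
  proof (intro equalityI subsetI)
    fix e assume "e \<in> {e \<in> E. v \<in> e}"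
    then have "e \<in> E" "v \<in> e" "card e = 2"
      using assms by (auto simp: finite_simple_graph_def)
    then show "e \<in> (\<lambda>w. {v, w}) ` {w. {v, w} \<in> E}"
      by (auto simp: card_2_iff image_iff) (metis insert_commute)
  qed auto
  moreover have "inj_on (\<lambda>w. {v, w}) {w. {v, w} \<in> E}"
    by (auto simp: inj_on_def doubleton_eq_iff)
  ultimately show ?thesis
    by (simp add: vertex_degree_def card_image)
qed

lemma edge_endpoints:
  assumes "finite_simple_graph V E" and "{v, w} \<in> E"
  shows "v \<in> V" "w \<in> V" "v \<noteq> w"
  using assms by (fastforce simp: finite_simple_graph_def)+

lemma finite_neighbours:
  assumes "finite_simple_graph V E"
  shows "finite {w. {v, w} \<in> E}"
  by (rule finite_subset[of _ V])
     (use assms edge_endpoints in \<open>fastforce simp: finite_simple_graph_def\<close>)+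

text \<open>Take a path from \<open>v\<close> to an endpoint \<open>a\<close> of some edge
  \<open>{a, b}\<close>. If it is trivial, \<open>b\<close> is a neighbour of \<open>v\<close>;
  otherwise its first step leads to one.\<close>

lemma connected_graph_obtain_neighbour:
  assumes "finite_simple_graph V E" and "connected_graph V E" and "E \<noteq> {}" and "v \<in> V"
  obtains w where "{v, w} \<in> E"
proof -
  obtain a b where ab: "{a, b} \<in> E"
    using assms(1,3) by (fastforce simp: finite_simple_graph_def card_2_iff)
  then have "(v, a) \<in> {(a, b). {a, b} \<in> E}\<^sup>*"
    using assms edge_endpoints[OF assms(1) ab] by (auto simp: connected_graph_def)
  then show thesis
    by (cases rule: converse_rtranclE) (use ab that in auto)
qed

text \<open>With D the diagonal degree matrix and A the adjacency matrix, L = I - D^(-1/2) A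
  D^(-1/2), hence L D^(1/2) h = D^(-1/2) (D - A) h.\<close>

lemma normalized_laplacian_mult:
  fixes h :: "'v \<Rightarrow> real"
  assumes G: "finite_simple_graph V E" and "distinct vs" and V: "set vs = V"
    and d: "\<And>v. v \<in> V \<Longrightarrow> vertex_degree E v > 0" and i: "i < length vs"
  defines "x \<equiv> Matrix.vec (length vs) (\<lambda>i. sqrt (vertex_degree E (vs ! i)) * h (vs ! i))"
  shows "(normalized_laplacian E vs *\<^sub>v x) $ i =
    (vertex_degree E (vs ! i) * h (vs ! i) - (\<Sum>w | {vs ! i, w} \<in> E. h w))
      / sqrt (vertex_degree E (vs ! i))"
proof -
  let ?d = "\<lambda>v. real (vertex_degree E v)" and ?v = "vs ! i"
  \<comment> \<open>\<open>F\<close> is row \<open>vs ! i\<close> of D - A applied to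
    \<open>h\<close>, term by term. The common denominator \<open>sqrt (?d ?v)\<close> comes out
    because the scaling of \<open>x\<close> cancels the other root in each matrix entry.\<close>
  define F where "F w = (if w = ?v then ?d ?v * h ?v else if {?v, w} \<in> E then - h w else 0)" for w
  have pos: "?d (vs ! j) > 0" if "j < length vs" for j
    using d V that by force
  have "(normalized_laplacian E vs *\<^sub>v x) $ i =
      (\<Sum>j<length vs. (normalized_laplacian E vs) $$ (i, j) * (sqrt (?d (vs ! j)) * h (vs ! j)))"
    using i by (simp add: scalar_prod_def x_def normalized_laplacian_def atLeast0LessThan)
  also have "\<dots> = (\<Sum>j<length vs. F (vs ! j) / sqrt (?d ?v))"
  proof (rule sum.cong)
    fix j assume "j \<in> {..<length vs}"
    then have j: "j < length vs" by simp
    have "(i = j) = (vs ! j = ?v)"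
      using i j \<open>distinct vs\<close> by (auto simp: nth_eq_iff_index_eq)
    moreover have "sqrt (?d ?v) * h ?v = ?d ?v * h ?v / sqrt (?d ?v)"
      using pos[OF i] by (simp add: field_simps)
    ultimately show "(normalized_laplacian E vs) $$ (i, j) * (sqrt (?d (vs ! j)) * h (vs ! j))
        = F (vs ! j) / sqrt (?d ?v)"
      using i j pos[OF j]
      by (cases "i = j") (simp_all add: normalized_laplacian_def F_def real_sqrt_mult)
  qed simp
  also have "\<dots> = (\<Sum>w\<in>V. F w) / sqrt (?d ?v)"
    using sum.reindex_bij_betw[OF bij_betw_nth[OF \<open>distinct vs\<close> refl refl], of F] V
    by (simp flip: sum_divide_distrib)
  also have "(\<Sum>w\<in>V. F w) = ?d ?v * h ?v + (\<Sum>w\<in>V - {?v}. F w)"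
    using i V by (subst sum.remove[of _ ?v]) (auto simp: F_def)
  also have "(\<Sum>w\<in>V - {?v}. F w) = (\<Sum>w | {?v, w} \<in> E. - h w)"
  proof (rule sum.mono_neutral_cong_right)
    show "finite (V - {?v})" using V by auto
    show "{w. {?v, w} \<in> E} \<subseteq> V - {?v}" using edge_endpoints[OF G] by blast
    show "\<forall>w\<in>V - {?v} - {w. {?v, w} \<in> E}. F w = 0" by (auto simp: F_def)
    fix w assume "w \<in> {w. {?v, w} \<in> E}"
    then show "F w = - h w" using edge_endpoints(3)[OF G, of ?v w] by (auto simp: F_def)
  qed
  finally show ?thesis by (simp add: sum_negf)
qed

text \<open>Positive degrees make the rescaling by D^(1/2) invertible, so every vector is a rescaled
  vertex function. Multiplying row i of L x = (1 - c) x by the root of the degree d leaves d h - S =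
  (1 - c) d h, where S is the neighbour sum.\<close>

lemma eigenvalue_normalized_laplacian_iff:
  fixes V :: "'v set" and c :: real
  assumes G: "finite_simple_graph V E" and vs: "distinct vs" "set vs = V"
    and d: "\<And>v. v \<in> V \<Longrightarrow> vertex_degree E v > 0"
  shows "eigenvalue (normalized_laplacian E vs) (1 - c) \<longleftrightarrow>
    (\<exists>h :: 'v \<Rightarrow> real. (\<exists>v\<in>V. h v \<noteq> 0) \<and> (\<forall>v\<in>V. (\<Sum>w | {v, w} \<in> E. h w) = vertex_degree E v * c * h v))"
    (is "_ \<longleftrightarrow> (\<exists>h. ?N h \<and> ?H h)")
proof -
  let ?L = "normalized_laplacian E vs" and ?n = "length vs" and ?d = "\<lambda>v. real (vertex_degree E v)"
  let ?x = "\<lambda>h. Matrix.vec ?n (\<lambda>i. sqrt (?d (vs ! i)) * h (vs ! i))"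
  have dim: "dim_row ?L = ?n" "dim_col ?L = ?n" by (auto simp: normalized_laplacian_def)
  have pos: "?d (vs ! j) > 0" if "j < length vs" for j
    using d vs that by force
  have key: "eigenvector ?L (?x h) (1 - c) \<longleftrightarrow> ?N h \<and> ?H h" for h :: "'v \<Rightarrow> real"
  proof -
    have "?x h \<noteq> 0\<^sub>v ?n \<longleftrightarrow> (\<exists>i<?n. h (vs ! i) \<noteq> 0)"
      using pos by (force simp: Matrix.vec_eq_iff)
    also have "\<dots> \<longleftrightarrow> ?N h"
      using all_set_conv_all_nth[of vs "\<lambda>v. h v = 0"] vs(2) by auto
    finally have N: "?x h \<noteq> 0\<^sub>v ?n \<longleftrightarrow> ?N h" .
    have "?L *\<^sub>v ?x h = (1 - c) \<cdot>\<^sub>v ?x h \<longleftrightarrow> (\<forall>i<?n. (?L *\<^sub>v ?x h) $ i = ((1 - c) \<cdot>\<^sub>v ?x h) $ i)"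
      by (auto simp: Matrix.vec_eq_iff dim)
    also have "\<dots> \<longleftrightarrow> (\<forall>i<?n. (\<Sum>w | {vs ! i, w} \<in> E. h w) = ?d (vs ! i) * c * h (vs ! i))"
    proof (intro all_cong1 imp_cong refl)
      fix i assume i: "i < ?n"
      let ?S = "\<Sum>w | {vs ! i, w} \<in> E. h w"
      have "(?L *\<^sub>v ?x h) $ i = ((1 - c) \<cdot>\<^sub>v ?x h) $ i \<longleftrightarrow>
          (?d (vs ! i) * h (vs ! i) - ?S) / sqrt (?d (vs ! i))
            = (1 - c) * (sqrt (?d (vs ! i)) * h (vs ! i))"
        using i normalized_laplacian_mult[OF G vs d i, of h] by simp
      also have "\<dots> \<longleftrightarrow> ?d (vs ! i) * h (vs ! i) - ?S = (1 - c) * (?d (vs ! i) * h (vs ! i))"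
        using pos[OF i] by (simp add: divide_eq_eq mult_ac)
      also have "\<dots> \<longleftrightarrow> ?S = ?d (vs ! i) * c * h (vs ! i)"
        by (auto simp: algebra_simps)
      finally show "(?L *\<^sub>v ?x h) $ i = ((1 - c) \<cdot>\<^sub>v ?x h) $ i \<longleftrightarrow> ?S = ?d (vs ! i) * c * h (vs ! i)" .
    qed
    also have "\<dots> \<longleftrightarrow> ?H h"
      unfolding vs(2)[symmetric] all_set_conv_all_nth by simp
    finally show ?thesis using N by (simp add: eigenvector_def dim)
  qed
  have repr: "\<exists>h. x = ?x h" if "x \<in> carrier_vec ?n" for x
  proof -
    \<comment> \<open>Inverse of the rescaling: distinctness of \<open>vs\<close> makes the index of
      a vertex unique. Values of \<open>h\<close> outside \<open>V\<close> are irrelevant.\<close>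
    define h where "h v = x $ (THE i. i < ?n \<and> vs ! i = v) / sqrt (?d v)" for v
    have "(THE j. j < ?n \<and> vs ! j = vs ! i) = i" if "i < ?n" for i
      using that vs by (intro the_equality) (auto simp: nth_eq_iff_index_eq)
    moreover have "sqrt (?d (vs ! i)) \<noteq> 0" if "i < ?n" for i
      using pos[OF that] by simp
    ultimately have "x = ?x h"
      using that by (intro eq_vecI) (simp_all add: h_def del: real_sqrt_eq_0_iff)
    then show ?thesis by blast
  qed
  show ?thesis
  proof
    assume "eigenvalue ?L (1 - c)"
    then obtain x where x: "eigenvector ?L x (1 - c)" by (auto simp: eigenvalue_def)
    then obtain h where "x = ?x h" using repr[of x] unfolding eigenvector_def dim by blast
    then show "\<exists>h. ?N h \<and> ?H h" using x key[of h] by blast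
  next
    assume "\<exists>h. ?N h \<and> ?H h"
    then show "eigenvalue ?L (1 - c)" using key unfolding eigenvalue_def by blast
  qed
qed

section \<open>Homogeneous harmonic functions on sectors\<close>

lemma oscillator_solution:
  fixes g g1 :: "real \<Rightarrow> real"
  assumes "a \<noteq> 0" and "T > 0" and cont: "continuous_on {0..T} g"
    and g: "\<And>x. x \<in> {0<..<T} \<Longrightarrow> (g has_real_derivative g1 x) (at x)"
    and g1: "\<And>x. x \<in> {0<..<T} \<Longrightarrow> (g1 has_real_derivative - a\<^sup>2 * g x) (at x)"
  obtains A B where "\<And>x. x \<in> {0..T} \<Longrightarrow> g x = A * cos (a * x) + B * sin (a * x)"
proof -
  \<comment> \<open>\<open>P\<close> and \<open>Q\<close> are the coordinates of the phase vector
    (g, g1/a) in a frame rotating with the oscillation. The differential equation makes both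
    constant, and rotating back recovers \<open>g\<close>.\<close>
  define P where "P x = g x * cos (a * x) - g1 x * sin (a * x) / a" for x
  define Q where "Q x = g x * sin (a * x) + g1 x * cos (a * x) / a" for x
  have "(P has_real_derivative 0) (at x within {0<..<T})" if "x \<in> {0<..<T}" for x
    unfolding P_def using \<open>a \<noteq> 0\<close>
    by (auto intro!: derivative_eq_intros DERIV_subset[OF g[OF that]] DERIV_subset[OF g1[OF that]]
      simp: power2_eq_square field_simps)
  then obtain A where A: "\<And>x. x \<in> {0<..<T} \<Longrightarrow> P x = A"
    using has_field_derivative_zero_constant[of "{0<..<T}" P] by auto
  have "(Q has_real_derivative 0) (at x within {0<..<T})" if "x \<in> {0<..<T}" for x
    unfolding Q_def using \<open>a \<noteq> 0\<close>
    by (auto intro!: derivative_eq_intros DERIV_subset[OF g[OF that]] DERIV_subset[OF g1[OF that]]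
      simp: power2_eq_square field_simps)
  then obtain B where B: "\<And>x. x \<in> {0<..<T} \<Longrightarrow> Q x = B"
    using has_field_derivative_zero_constant[of "{0<..<T}" Q] by auto
  have open_sol: "g x - (A * cos (a * x) + B * sin (a * x)) = 0" if "x \<in> {0<..<T}" for x
  proof -
    have "P x * cos (a * x) + Q x * sin (a * x) = g x * ((cos (a * x))\<^sup>2 + (sin (a * x))\<^sup>2)"
      unfolding P_def Q_def by (simp add: algebra_simps power2_eq_square
        del: sin_cos_squared_add sin_cos_squared_add2 sin_cos_squared_add3)
    then show ?thesis using A[OF that] B[OF that] by simp
  qed
  \<comment> \<open>The equation is only known inside the interval; continuity of \<open>g\<close>
    carries the solution to the endpoints, where boundary values will be read off.\<close>
  have "g x - (A * cos (a * x) + B * sin (a * x)) = 0" if "x \<in> {0..T}" for x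
    by (rule continuous_constant_on_closure[of "{0<..<T}" "\<lambda>x. g x - (A * cos (a * x) + B * sin (a * x))"])
       (use that open_sol \<open>T > 0\<close> in \<open>auto intro!: continuous_intros cont\<close>)
  then show thesis by (intro that[of A B]) auto
qed

lemma harmonic_on_cong:
  assumes "harmonic_on u S" and "\<And>x. x \<in> S \<Longrightarrow> u x = v x"
  shows "harmonic_on v S"
proof -
  have "(v has_derivative D) (at x)" if "open S" "x \<in> S" "(u has_derivative D) (at x)" for x D
    using that assms(2) has_derivative_transform_within_open by blast
  then show ?thesis using assms(1) unfolding harmonic_on_def by blast
qed

text \<open>The gradient of Re F is the conjugate of F', and its derivative in direction h is the
  conjugate of F'' h. The directions 1 and i contribute Re F'' and -Re F'' to the trace.\<close>

lemma harmonic_on_Re_holomorphic: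
  assumes "open S" and F: "\<And>z. z \<in> S \<Longrightarrow> (F has_field_derivative F1 z) (at z)"
    and F1: "\<And>z. z \<in> S \<Longrightarrow> (F1 has_field_derivative F2 z) (at z)"
    and F2: "continuous_on S F2"
  shows "harmonic_on (\<lambda>z. Re (F z)) S"
  unfolding harmonic_on_def
proof (intro conjI exI[of _ "\<lambda>z. cnj (F1 z)"] exI[of _ "\<lambda>z h. cnj (F2 z * h)"] ballI)
  fix z assume z: "z \<in> S"
  have "((\<lambda>z. Re (F z)) has_derivative (\<lambda>h. Re (F1 z * h))) (at z)"
    by (rule has_derivative_Re[OF F[OF z, unfolded has_field_derivative_def]])
  then show "((\<lambda>z. Re (F z)) has_derivative (\<lambda>h. cnj (F1 z) \<bullet> h)) (at z)"
    by (simp add: inner_complex_def)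
  show "((\<lambda>z. cnj (F1 z)) has_derivative (\<lambda>h. cnj (F2 z * h))) (at z)"
    by (rule has_derivative_cnj[OF F1[OF z, unfolded has_field_derivative_def]])
  show "(\<Sum>b\<in>Basis. cnj (F2 z * b) \<bullet> b) = 0"
    by (simp add: Basis_complex_def inner_complex_def)
qed (use assms in \<open>auto intro!: continuous_intros\<close>)

text \<open>For a function homogeneous of degree \<open>\<alpha>\<close>, the radial part of the Hessian is known, so the
  vanishing of its trace determines the second derivative along the unit circle.\<close>

lemma homogeneous_harmonic_angular:
  fixes u :: "complex \<Rightarrow> real"
  assumes harm: "harmonic_on u S"
    and S: "\<And>r \<phi>. 0 < r \<Longrightarrow> 0 < \<phi> \<Longrightarrow> \<phi> < T \<Longrightarrow> rcis r \<phi> \<in> S"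
    and u: "\<And>r \<phi>. 0 < r \<Longrightarrow> 0 < \<phi> \<Longrightarrow> \<phi> < T \<Longrightarrow> u (rcis r \<phi>) = g \<phi> * r powr a"
  obtains g1 where "\<And>\<phi>. \<phi> \<in> {0<..<T} \<Longrightarrow> (g has_real_derivative g1 \<phi>) (at \<phi>)"
    and "\<And>\<phi>. \<phi> \<in> {0<..<T} \<Longrightarrow> (g1 has_real_derivative - a\<^sup>2 * g \<phi>) (at \<phi>)"
proof -
  obtain G H where "\<forall>z\<in>S. (u has_derivative (\<lambda>h. G z \<bullet> h)) (at z) \<and> (G has_derivative H z) (at z)"
      "\<forall>z\<in>S. (\<Sum>b\<in>Basis. H z b \<bullet> b) = 0"
    using harm unfolding harmonic_on_def by blast
  then have G: "\<And>z. z \<in> S \<Longrightarrow> (u has_derivative (\<lambda>h. G z \<bullet> h)) (at z)"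
    and H: "\<And>z. z \<in> S \<Longrightarrow> (G has_derivative H z) (at z)"
    and tr: "\<And>z. z \<in> S \<Longrightarrow> (\<Sum>b\<in>Basis. H z b \<bullet> b) = 0"
    by simp_all
  define g1 where "g1 \<phi> = G (cis \<phi>) \<bullet> (\<i> * cis \<phi>)" for \<phi>
  have cis_deriv: "(cis has_derivative (\<lambda>h. h *\<^sub>R (\<i> * cis \<phi>))) (at \<phi>)" for \<phi>
    by (auto intro!: derivative_eq_intros)
  have gd: "(g has_real_derivative g1 \<phi>) (at \<phi>)" if "\<phi> \<in> {0<..<T}" for \<phi>
  proof -
    have z: "cis \<phi> \<in> S" using S[of 1 \<phi>] that by (simp add: rcis_def)
    have "((\<lambda>\<phi>. u (cis \<phi>)) has_derivative (\<lambda>h. G (cis \<phi>) \<bullet> (h *\<^sub>R (\<i> * cis \<phi>)))) (at \<phi>)"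
      by (rule has_derivative_compose[OF cis_deriv G[OF z]])
    then have "((\<lambda>\<phi>. u (cis \<phi>)) has_real_derivative g1 \<phi>) (at \<phi>)"
      by (simp add: has_field_derivative_def g1_def mult.commute[of _ "_ \<bullet> _"])
    then show ?thesis
      by (rule has_field_derivative_transform_within_open[of _ _ _ "{0<..<T}"])
         (use that u[of 1] in \<open>auto simp: rcis_def\<close>)
  qed
  have g1d: "(g1 has_real_derivative - a\<^sup>2 * g \<phi>) (at \<phi>)" if \<phi>: "\<phi> \<in> {0<..<T}" for \<phi>
  proof -
    let ?z = "cis \<phi>"
    have z: "?z \<in> S" using S[of 1 \<phi>] that by (simp add: rcis_def)
    have lin: "linear (H ?z)" using H[OF z] has_derivative_linear by blast
    have ray: "((\<lambda>r. complex_of_real r * ?z) has_derivative (\<lambda>h. h *\<^sub>R ?z)) (at r)" for r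
      by (auto intro!: derivative_eq_intros simp: scaleR_conv_of_real)
    \<comment> \<open>Homogeneity fixes the radial derivative along the whole ray, so it can be
      differentiated once more at r = 1, giving the radial entry of the Hessian.\<close>
    have radial: "G (complex_of_real r * ?z) \<bullet> ?z = g \<phi> * (a * r powr (a - 1))" if "r > 0" for r
    proof -
      have rz: "of_real r * ?z \<in> S" using S[of r \<phi>] that \<phi> by (simp add: rcis_def)
      have "((\<lambda>r. u (complex_of_real r * ?z)) has_derivative
          (\<lambda>h. G (of_real r * ?z) \<bullet> (h *\<^sub>R ?z))) (at r)"
        by (rule has_derivative_compose[OF ray G[OF rz]])
      then have "((\<lambda>r. u (complex_of_real r * ?z)) has_real_derivative
          G (of_real r * ?z) \<bullet> ?z) (at r)"
        by (simp add: has_field_derivative_def mult.commute[of _ "_ \<bullet> _"])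
      then have "((\<lambda>r. g \<phi> * r powr a) has_real_derivative G (of_real r * ?z) \<bullet> ?z) (at r)"
        by (rule has_field_derivative_transform_within_open[of _ _ _ "{0<..}"])
           (use that u \<phi> in \<open>auto simp: rcis_def\<close>)
      moreover have "((\<lambda>r. g \<phi> * r powr a) has_real_derivative g \<phi> * (a * r powr (a - 1))) (at r)"
        using that by (auto intro!: derivative_eq_intros)
      ultimately show ?thesis by (rule DERIV_unique)
    qed
    have "((\<lambda>r. G (complex_of_real r * ?z)) has_derivative (\<lambda>h. H ?z (h *\<^sub>R ?z))) (at 1)"
      using has_derivative_compose[OF ray[of 1], of G "H ?z"] H[OF z] by simp
    then have "((\<lambda>r. G (complex_of_real r * ?z) \<bullet> ?z) has_derivative
        (\<lambda>h. H ?z (h *\<^sub>R ?z) \<bullet> ?z)) (at 1)"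
      by (rule has_derivative_inner_left)
    then have "((\<lambda>r. G (complex_of_real r * ?z) \<bullet> ?z) has_real_derivative H ?z ?z \<bullet> ?z) (at 1)"
      by (simp add: has_field_derivative_def linear_cmul[OF lin] mult.commute[of _ "_ \<bullet> _"])
    then have "((\<lambda>r. g \<phi> * (a * r powr (a - 1))) has_real_derivative H ?z ?z \<bullet> ?z) (at 1)"
      by (rule has_field_derivative_transform_within_open[of _ _ _ "{0<..}"]) (auto simp: radial)
    moreover have "((\<lambda>r. g \<phi> * (a * r powr (a - 1))) has_real_derivative g \<phi> * (a * (a - 1))) (at 1)"
      by (auto intro!: derivative_eq_intros)
    ultimately have Hrad: "H ?z ?z \<bullet> ?z = g \<phi> * (a * (a - 1))" by (rule DERIV_unique)
    \<comment> \<open>\<open>?z\<close> and \<open>\<i> * ?z\<close> form an orthonormal basis, and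
      the vanishing trace is invariant under rotation. Symmetry of the Hessian does not
      enter.\<close>
    have Hang: "H ?z (\<i> * ?z) \<bullet> (\<i> * ?z) = - (H ?z ?z \<bullet> ?z)"
    proof -
      have "?z = cos \<phi> *\<^sub>R 1 + sin \<phi> *\<^sub>R \<i>"
        "\<i> * ?z = (- sin \<phi>) *\<^sub>R 1 + cos \<phi> *\<^sub>R \<i>"
        by (simp_all add: complex_eq_iff)
      then have 1: "H ?z ?z = cos \<phi> *\<^sub>R H ?z 1 + sin \<phi> *\<^sub>R H ?z \<i>"
        and 2: "H ?z (\<i> * ?z) = (- sin \<phi>) *\<^sub>R H ?z 1 + cos \<phi> *\<^sub>R H ?z \<i>"
        by (metis linear_add[OF lin] linear_cmul[OF lin])+
      have "Im (H ?z \<i>) = - Re (H ?z 1)"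
        using tr[OF z] by (simp add: Basis_complex_def inner_complex_def)
      then show ?thesis
        unfolding 1 2 by (simp add: inner_complex_def algebra_simps)
    qed
    have "((\<lambda>\<phi>. G (cis \<phi>)) has_derivative (\<lambda>h. H ?z (h *\<^sub>R (\<i> * ?z)))) (at \<phi>)"
      by (rule has_derivative_compose[OF cis_deriv H[OF z]])
    moreover have "((\<lambda>\<phi>. \<i> * cis \<phi>) has_derivative (\<lambda>h. h *\<^sub>R (- ?z))) (at \<phi>)"
      by (auto intro!: derivative_eq_intros simp: fun_eq_iff complex_eq_iff)
    ultimately have "(g1 has_derivative
        (\<lambda>h. G ?z \<bullet> (h *\<^sub>R (- ?z)) + H ?z (h *\<^sub>R (\<i> * ?z)) \<bullet> (\<i> * ?z))) (at \<phi>)"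
      unfolding g1_def by (rule has_derivative_inner)
    \<comment> \<open>The curvature of the circle contributes -a g and the angular Hessian entry -a
      (a - 1) g; together they give -a^2 g.\<close>
    moreover have "G ?z \<bullet> (h *\<^sub>R (- ?z)) + H ?z (h *\<^sub>R (\<i> * ?z)) \<bullet> (\<i> * ?z) = - a\<^sup>2 * g \<phi> * h" for h
      using radial[of 1] Hrad Hang
      by (simp add: linear_cmul[OF lin] power2_eq_square) (simp add: algebra_simps)
    ultimately show ?thesis by (simp only: has_field_derivative_def)
  qed
  show thesis using that gd g1d by blast
qed

section \<open>Functions on the cone\<close>

text \<open>An angle below pi keeps the sector in the closed upper half-plane, hence its interior in
  the open one. The origin is thus excluded and \<open>Arg\<close> recovers the polar angle.\<close>

lemma interior_sectorD:
  assumes "T < pi" and z: "z \<in> interior (sector T)"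
  shows "Im z > 0" "0 \<le> Arg z" "Arg z \<le> T"
proof -
  have "sector T \<subseteq> {z. Im z \<ge> 0}"
    using \<open>T < pi\<close> by (auto simp: sector_def intro!: mult_nonneg_nonneg sin_ge_zero)
  then have "interior (sector T) \<subseteq> {z. Im z > 0}"
    using interior_mono[of "sector T" "{z. Im z \<ge> 0}"] interior_halfspace_ge[of \<i> 0]
    by (simp add: inner_complex_def)
  then show "Im z > 0" using z by blast
  obtain r \<phi> where r: "z = rcis r \<phi>" "0 \<le> r" "0 \<le> \<phi>" "\<phi> \<le> T"
    using interior_subset[of "sector T"] z by (auto simp: sector_def)
  moreover have "r \<noteq> 0" using \<open>Im z > 0\<close> r by auto
  ultimately have "Arg z = \<phi>"
    using \<open>T < pi\<close> by (simp add: Arg_rcis)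
  then show "0 \<le> Arg z" "Arg z \<le> T" using r by auto
qed

text \<open>\<open>Arg\<close> is continuous on the open upper half-plane, so the points there with
  argument strictly between 0 and \<open>T\<close> form an open subset of the sector.\<close>

lemma rcis_in_interior_sector:
  assumes "T < pi" "0 < r" "0 < \<phi>" "\<phi> < T"
  shows "rcis r \<phi> \<in> interior (sector T)"
proof -
  let ?U = "{z. Im z > 0} \<inter> Arg -` {0<..<T}"
  have "continuous_on {z. Im z > 0} Arg"
    by (intro continuous_at_imp_continuous_on ballI continuous_at_Arg)
       (auto simp: complex_nonpos_Reals_iff)
  then have "open ?U"
    by (rule continuous_open_preimage) (auto simp: open_halfspace_Im_gt)
  moreover have "?U \<subseteq> sector T"
  proof
    fix z assume "z \<in> ?U"
    then have "z = rcis (cmod z) (Arg z)" "0 \<le> cmod z" "0 \<le> Arg z" "Arg z \<le> T"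
      by (auto simp: rcis_cmod_Arg)
    then show "z \<in> sector T" unfolding sector_def by blast
  qed
  moreover have "Arg (rcis r \<phi>) = \<phi>" using assms by (simp add: Arg_rcis)
  then have "rcis r \<phi> \<in> ?U" using assms by (simp add: sin_gt_zero)
  ultimately show ?thesis by (meson interiorI)
qed

lemma powr_of_real_eq_rcis:
  assumes "z \<noteq> 0"
  shows "z powr complex_of_real a = rcis (cmod z powr a) (a * Arg z)"
  using assms by (intro complex_eqI) (simp_all add: powr_def Re_exp Im_exp Arg_eq_Im_Ln)

text \<open>Connectedness enters as the absence of isolated vertices, and the condition on the angle
  as \<open>sin (\<alpha> * \<theta>\<^sub>0) \<noteq> 0\<close>, which makes the boundary value
  problem on an edge uniquely solvable.\<close>

locale equiangular_cone =
  fixes V :: "'v set" and E :: "'v set set" and \<theta> :: "'v set \<Rightarrow> real" and \<theta>\<^sub>0 \<alpha> :: real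
  assumes graph: "finite_simple_graph V E"
    and neighbour: "\<And>v. v \<in> V \<Longrightarrow> \<exists>w. {v, w} \<in> E"
    and angle_pos: "0 < \<theta>\<^sub>0" and angle_less_pi: "\<theta>\<^sub>0 < pi"
    and angle: "\<And>e. e \<in> E \<Longrightarrow> \<theta> e = \<theta>\<^sub>0"
    and degree_pos: "0 < \<alpha>" and sin_nonzero: "sin (\<alpha> * \<theta>\<^sub>0) \<noteq> 0"
begin

section \<open>The graph covered by its edges\<close>

lemma finite_V: "finite V"
  using graph by (simp add: finite_simple_graph_def)

lemma sum_edge:
  assumes "{v, w} \<in> E" and "\<And>a. a \<in> V - {v, w} \<Longrightarrow> F a = (0::real)"
  shows "(\<Sum>a\<in>V. F a) = F v + F w"
proof -
  note vw = edge_endpoints[OF graph assms(1)]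
  have "(\<Sum>a\<in>V. F a) = (\<Sum>a\<in>{v, w}. F a)"
    by (rule sum.mono_neutral_right) (use finite_V vw assms(2) in auto)
  then show ?thesis using vw by simp
qed

lemma edge_point_in_graph_space:
  assumes "{v, w} \<in> E" and "0 \<le> x" "x \<le> 1"
  shows "edge_point v w x \<in> graph_space V E"
proof -
  note vw = edge_endpoints[OF graph assms(1)]
  have "(\<Sum>a\<in>V. edge_point v w x a) = 1"
    using vw by (subst sum_edge[OF assms(1)]) (auto simp: edge_point_def)
  moreover have "{a. edge_point v w x a \<noteq> 0} = (if x = 0 then {v} else if x = 1 then {w} else {v, w})"
    using vw by (auto simp: edge_point_def)
  ultimately show ?thesis
    using assms vw by (auto simp: graph_space_def edge_point_def)
qed

text \<open>A point supported on a single vertex also lies on an edge, since that vertex has a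
  neighbour. The edge parameter is the barycentric coordinate of \<open>w\<close>.\<close>

lemma graph_space_cases:
  assumes "p \<in> graph_space V E"
  obtains v w x where "{v, w} \<in> E" "0 \<le> x" "x \<le> 1" "p = edge_point v w x"
proof -
  have p: "\<And>a. 0 \<le> p a" "(\<Sum>a\<in>V. p a) = 1" "{a. p a \<noteq> 0} \<in> E \<union> (\<lambda>v. {v}) ` V"
    using assms by (auto simp: graph_space_def)
  obtain v w where vw: "{v, w} \<in> E" "{a. p a \<noteq> 0} \<subseteq> {v, w}"
  proof (cases "{a. p a \<noteq> 0} \<in> E")
    case True
    then obtain v w where "{a. p a \<noteq> 0} = {v, w}"
      using graph by (auto simp: finite_simple_graph_def card_2_iff)
    then show thesis using True that[of v w] by auto
  next
    case False
    then obtain v where "v \<in> V" "{a. p a \<noteq> 0} = {v}" using p(3) by auto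
    then show thesis using neighbour[of v] that[of v] by auto
  qed
  have "p v + p w = 1" using sum_edge[OF vw(1), of p] vw(2) p(2) by auto
  then have "p = edge_point v w (p w)"
    using vw(2) edge_endpoints(3)[OF graph vw(1)] by (auto simp: edge_point_def fun_eq_iff)
  then show thesis
    using that[of v w "p w"] vw(1) p(1)[of v] p(1)[of w] \<open>p v + p w = 1\<close> by auto
qed

text \<open>On an edge, parametrised by the angle, the solution of \<open>g'' = - \<alpha>\<^sup>2 g\<close> with boundary
  values \<open>h\<close> is a combination of two sines; in barycentric coordinates each of them depends on one
  coordinate only, which gives a formula valid on the whole graph.\<close>

definition interpolate :: "('v \<Rightarrow> real) \<Rightarrow> ('v \<Rightarrow> real) \<Rightarrow> real" where
  "interpolate h p = (\<Sum>v\<in>V. h v * sin (\<alpha> * \<theta>\<^sub>0 * p v)) / sin (\<alpha> * \<theta>\<^sub>0)"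

lemma interpolate_edge_point:
  assumes "{v, w} \<in> E"
  shows "interpolate h (edge_point v w (\<phi> / \<theta>\<^sub>0)) =
    (h v * sin (\<alpha> * (\<theta>\<^sub>0 - \<phi>)) + h w * sin (\<alpha> * \<phi>)) / sin (\<alpha> * \<theta>\<^sub>0)"
proof -
  note vw = edge_endpoints[OF graph assms]
  have angles: "\<alpha> * \<theta>\<^sub>0 * (1 - \<phi> / \<theta>\<^sub>0) = \<alpha> * (\<theta>\<^sub>0 - \<phi>)" "\<alpha> * \<theta>\<^sub>0 * (\<phi> / \<theta>\<^sub>0) = \<alpha> * \<phi>"
    using angle_pos by (simp_all add: field_simps)
  have "edge_point v w x v = 1 - x" "edge_point v w x w = x"
    "a \<in> V - {v, w} \<Longrightarrow> edge_point v w x a = 0" for a x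
    using vw by (auto simp: edge_point_def)
  then show ?thesis
    unfolding interpolate_def by (subst sum_edge[OF assms]) (simp_all only: angles mult_zero_right sin_zero)
qed

section \<open>Extending vertex values to the cone\<close>

definition cone_extension :: "((('v \<Rightarrow> real) \<times> real) set \<Rightarrow> real) \<Rightarrow> ('v \<Rightarrow> real) \<Rightarrow> bool" where
  "cone_extension f h \<longleftrightarrow>
    (\<forall>p\<in>graph_space V E. \<forall>t\<ge>0. f (cone_point V E p t) = interpolate h p * t powr \<alpha>)"

lemma cone_extension_exists: "\<exists>f. cone_extension f h"
proof -
  define f where "f c = (case SOME y. y \<in> c of (p, t) \<Rightarrow> interpolate h p * t powr \<alpha>)"
    for c :: "(('v \<Rightarrow> real) \<times> real) set"
  have "f (cone_point V E p t) = interpolate h p * t powr \<alpha>"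
    if "p \<in> graph_space V E" "t \<ge> 0" for p t
  proof -
    obtain q s where qs: "(SOME y. y \<in> cone_point V E p t) = (q, s)" by fastforce
    have "(p, t) \<in> cone_point V E p t"
      using that by (simp add: cone_point_def cone_rel_def)
    then have "(q, s) \<in> cone_point V E p t" using qs by (metis someI)
    \<comment> \<open>The chosen representative can differ from \<open>(p, t)\<close> only at the
      apex, where both radii are 0 and the factor \<open>t powr \<alpha>\<close> vanishes.\<close>
    then have "p = q \<and> t = s \<or> t = 0 \<and> s = 0"
      by (auto simp: cone_point_def cone_rel_def)
    then show ?thesis by (auto simp: f_def qs)
  qed
  then show ?thesis by (auto simp: cone_extension_def)
qed

lemma cone_extension_face:
  assumes "cone_extension f h" "{v, w} \<in> E" "0 \<le> \<phi>" "\<phi> \<le> \<theta>\<^sub>0" "0 \<le> r"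
  shows "f (face_polar V E \<theta> v w r \<phi>) =
    (h v * sin (\<alpha> * (\<theta>\<^sub>0 - \<phi>)) + h w * sin (\<alpha> * \<phi>)) / sin (\<alpha> * \<theta>\<^sub>0) * r powr \<alpha>"
proof -
  have "edge_point v w (\<phi> / \<theta>\<^sub>0) \<in> graph_space V E"
    using assms angle_pos by (intro edge_point_in_graph_space) auto
  then show ?thesis
    using assms angle[OF assms(2)]
    by (simp add: face_polar_def cone_extension_def interpolate_edge_point)
qed

lemma cone_extension_homogeneous:
  assumes "cone_extension f h"
  shows "cone_homogeneous V E \<alpha> f"
  unfolding cone_homogeneous_def
proof (intro exI conjI)
  have "continuous_on UNIV (\<lambda>x. sin (\<alpha> * \<theta>\<^sub>0 * x))"
    by (intro continuous_intros)
  moreover have "continuous_on (graph_space V E) (\<lambda>p. p v)" for v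
    by (rule continuous_on_product_then_coordinatewise) (rule continuous_on_id)
  ultimately have "continuous_on (graph_space V E) (\<lambda>p. sin (\<alpha> * \<theta>\<^sub>0 * p v))" for v
    by (rule continuous_on_compose2) auto
  then show "continuous_on (graph_space V E) (interpolate h)"
    unfolding interpolate_def using sin_nonzero
    by (intro continuous_on_divide continuous_on_sum continuous_on_mult continuous_on_const) auto
qed (use assms in \<open>simp add: cone_extension_def\<close>)

text \<open>On each face the extension is the real part of c z^\<alpha>, holomorphic there because
  the open sector avoids the closed negative real axis.\<close>

lemma cone_extension_harmonic:
  assumes "cone_extension f h"
  shows "cone_harmonic V E \<theta> f"
  unfolding cone_harmonic_def
proof (intro allI impI)
  fix v w assume e: "{v, w} \<in> E"
  let ?S = "interior (sector \<theta>\<^sub>0)" and ?s = "sin (\<alpha> * \<theta>\<^sub>0)"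
  \<comment> \<open>Re (c z^\<alpha>) is r^\<alpha> (Re c cos(\<alpha> \<phi>) - Im c sin(\<alpha>
    \<phi>)). The value \<open>h v\<close> at angle 0 fixes Re c, and the value \<open>h w\<close>
    on the other ray then fixes Im c.\<close>
  define c where "c = Complex (h v) ((h v * cos (\<alpha> * \<theta>\<^sub>0) - h w) / ?s)"
  have nonpos: "z \<notin> \<real>\<^sub>\<le>\<^sub>0" if "z \<in> ?S" for z
    using interior_sectorD(1)[OF angle_less_pi that] by (auto simp: complex_nonpos_Reals_iff)
  have deriv: "((\<lambda>z. b * z powr s) has_field_derivative b * s * z powr (s - 1)) (at z)"
    if "z \<in> ?S" for b s z :: complex
    using nonpos[OF that] by (auto intro!: derivative_eq_intros)
  have "harmonic_on (\<lambda>z. Re (c * z powr of_real \<alpha>)) ?S"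
    by (rule harmonic_on_Re_holomorphic[OF open_interior deriv deriv])
       (auto intro: continuous_at_imp_continuous_on DERIV_isCont[OF deriv])
  then show "harmonic_on (\<lambda>z. f (face_polar V E \<theta> v w (cmod z) (Arg z))) (interior (sector (\<theta> {v, w})))"
    unfolding angle[OF e]
  proof (rule harmonic_on_cong)
    fix z assume z: "z \<in> ?S"
    note zD = interior_sectorD[OF angle_less_pi z]
    then have "z \<noteq> 0" by auto
    then show "Re (c * z powr of_real \<alpha>) = f (face_polar V E \<theta> v w (cmod z) (Arg z))"
      using zD sin_nonzero
      by (simp add: cone_extension_face[OF assms e] powr_of_real_eq_rcis c_def
          right_diff_distrib sin_diff field_simps)
  qed
qed

lemma cone_extension_balanced_iff:
  assumes "cone_extension f h"
  shows "cone_balanced V E \<theta> f \<longleftrightarrow>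
    (\<forall>v\<in>V. (\<Sum>w | {v, w} \<in> E. h w) = vertex_degree E v * cos (\<alpha> * \<theta>\<^sub>0) * h v)"
proof -
  let ?c = "cos (\<alpha> * \<theta>\<^sub>0)" and ?s = "sin (\<alpha> * \<theta>\<^sub>0)"
  \<comment> \<open>Derivative at angle 0 of the two-sine formula; its prefactor is nonzero and
    independent of \<open>w\<close>, so it drops out of the balancing sum.\<close>
  define D where "D v r w = \<alpha> * r powr \<alpha> / ?s * (h w - ?c * h v)" for v r w
  let ?deriv = "\<lambda>v w r d. ((\<lambda>\<phi>. f (face_polar V E \<theta> v w r \<phi>)) has_real_derivative d) (at 0 within {0..\<theta> {v, w}})"
  have deriv: "?deriv v w r (D v r w)" if e: "{v, w} \<in> E" and "r > 0" for v w r
  proof -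
    let ?g = "\<lambda>\<phi>. (h v * sin (\<alpha> * (\<theta>\<^sub>0 - \<phi>)) + h w * sin (\<alpha> * \<phi>)) / ?s * r powr \<alpha>"
    have "(?g has_real_derivative D v r w) (at 0 within {0..\<theta>\<^sub>0})"
      unfolding D_def using sin_nonzero
      by (auto intro!: derivative_eq_intros simp: field_simps)
    then show ?thesis
      unfolding angle[OF e]
      by (rule has_field_derivative_transform_within[where d = 1])
         (use angle_pos \<open>r > 0\<close> cone_extension_face[OF assms e] in auto)
  qed
  \<comment> \<open>Balancing provides some one-sided derivatives. They must be the computed ones
    because 0 is a limit point of the angular interval.\<close>
  have unique: "d = D v r w" if "{v, w} \<in> E" "r > 0" "?deriv v w r d" for v w r d
  proof -
    have "at 0 within {0..\<theta>\<^sub>0} \<noteq> bot"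
      using angle_pos by (simp add: at_within_Icc_at_right)
    then show ?thesis
      using deriv[OF that(1,2)] that(3) angle[OF that(1)]
      by (auto simp: has_field_derivative_iff intro: tendsto_unique)
  qed
  have sum_D: "(\<Sum>w | {v, w} \<in> E. D v r w) = 0 \<longleftrightarrow>
      (\<Sum>w | {v, w} \<in> E. h w) = vertex_degree E v * ?c * h v" if "r > 0" for v r
  proof -
    have "(\<Sum>w | {v, w} \<in> E. D v r w) =
        \<alpha> * r powr \<alpha> / ?s * ((\<Sum>w | {v, w} \<in> E. h w) - vertex_degree E v * ?c * h v)"
      unfolding D_def sum_distrib_left[symmetric] sum_subtractf
        vertex_degree_eq_card_neighbours[OF graph] by simp
    then show ?thesis using that degree_pos sin_nonzero by simp
  qed
  show ?thesis
    unfolding cone_balanced_def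
  proof (intro ball_cong refl)
    fix v assume "v \<in> V"
    show "(\<forall>r>0. \<exists>D. (\<forall>w. {v, w} \<in> E \<longrightarrow> ?deriv v w r (D w)) \<and> (\<Sum>w | {v, w} \<in> E. D w) = 0)
        \<longleftrightarrow> (\<Sum>w | {v, w} \<in> E. h w) = vertex_degree E v * ?c * h v" (is "?B \<longleftrightarrow> ?H")
    proof
      assume B: ?B
      \<comment> \<open>A single radius suffices, since the vertex condition does not involve
        \<open>r\<close>.\<close>
      have one: "(0::real) < 1" by simp
      obtain d where "\<forall>w. {v, w} \<in> E \<longrightarrow> ?deriv v w 1 (d w)" "(\<Sum>w | {v, w} \<in> E. d w) = 0"
        using B[rule_format, OF one] by blast
      moreover from this have "d w = D v 1 w" if "{v, w} \<in> E" for w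
        using unique[OF that one] that by blast
      ultimately have "(\<Sum>w | {v, w} \<in> E. D v 1 w) = 0" by simp
      then show ?H using sum_D[of 1 v] by simp
    next
      assume H: ?H
      show ?B
      proof (intro allI impI)
        fix r :: real assume r: "r > 0"
        have "\<forall>w. {v, w} \<in> E \<longrightarrow> ?deriv v w r (D v r w)" using deriv r by blast
        moreover have "(\<Sum>w | {v, w} \<in> E. D v r w) = 0" using H sum_D[OF r] by blast
        ultimately show "\<exists>D. (\<forall>w. {v, w} \<in> E \<longrightarrow> ?deriv v w r (D w)) \<and> (\<Sum>w | {v, w} \<in> E. D w) = 0"
          by blast
      qed
    qed
  qed
qed

text \<open>Vanishing vertex values make \<open>interpolate\<close> vanish; conversely,
  \<open>h v\<close> is the value of \<open>f\<close> at radius 1 on the ray over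
  \<open>v\<close>.\<close>

lemma cone_extension_nonzero_iff:
  assumes "cone_extension f h"
  shows "(\<exists>z\<in>graph_cone V E. f z \<noteq> 0) \<longleftrightarrow> (\<exists>v\<in>V. h v \<noteq> 0)"
proof
  assume "\<exists>z\<in>graph_cone V E. f z \<noteq> 0"
  then obtain p t where "p \<in> graph_space V E" "t \<ge> 0" "f (cone_point V E p t) \<noteq> 0"
    by (auto simp: graph_cone_def cone_point_def elim!: quotientE)
  then have "interpolate h p \<noteq> 0" using assms by (auto simp: cone_extension_def)
  then show "\<exists>v\<in>V. h v \<noteq> 0" by (force simp: interpolate_def intro: sum.neutral)
next
  assume "\<exists>v\<in>V. h v \<noteq> 0"
  then obtain v w where v: "h v \<noteq> 0" and e: "{v, w} \<in> E" using neighbour by blast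
  have "edge_point v w 0 \<in> graph_space V E" using e by (simp add: edge_point_in_graph_space)
  then have "cone_point V E (edge_point v w 0) 1 \<in> graph_cone V E"
    by (auto simp: cone_point_def graph_cone_def intro!: quotientI)
  moreover have "f (cone_point V E (edge_point v w 0) 1) = h v"
    using cone_extension_face[OF assms e, of 0 1] angle_pos sin_nonzero by (simp add: face_polar_def)
  ultimately show "\<exists>z\<in>graph_cone V E. f z \<noteq> 0" using v by metis
qed

text \<open>Take \<open>h\<close> to be the values of \<open>\<rho>\<close> at the vertices. On each
  edge \<open>\<rho>\<close> solves the oscillator equation in the angle, and so does the
  interpolation; equal endpoint values force them to agree.\<close>

lemma homogeneous_harmonic_imp_cone_extension:
  assumes "cone_homogeneous V E \<alpha> f" and harm: "cone_harmonic V E \<theta> f"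
  obtains h where "cone_extension f h"
proof -
  obtain \<rho> where cont: "continuous_on (graph_space V E) \<rho>"
    and \<rho>: "\<And>p t. p \<in> graph_space V E \<Longrightarrow> t \<ge> 0 \<Longrightarrow> f (cone_point V E p t) = \<rho> p * t powr \<alpha>"
    using assms(1) by (auto simp: cone_homogeneous_def)
  define h where "h v = \<rho> ((\<lambda>_. 0)(v := 1))" for v
  have "\<rho> p = interpolate h p" if p_in: "p \<in> graph_space V E" for p
  proof -
    obtain v w x where e: "{v, w} \<in> E" and x: "0 \<le> x" "x \<le> 1" and p: "p = edge_point v w x"
      using graph_space_cases[OF p_in] by blast
    note vw = edge_endpoints[OF graph e]
    define g where "g \<phi> = \<rho> (edge_point v w (\<phi> / \<theta>\<^sub>0))" for \<phi>
    have in_space: "edge_point v w (\<phi> / \<theta>\<^sub>0) \<in> graph_space V E" if "\<phi> \<in> {0..\<theta>\<^sub>0}" for \<phi>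
      using that angle_pos e by (intro edge_point_in_graph_space) auto
    have "continuous_on {0..\<theta>\<^sub>0} (\<lambda>\<phi>. edge_point v w (\<phi> / \<theta>\<^sub>0))"
    proof (rule continuous_on_coordinatewise_then_product)
      show "continuous_on {0..\<theta>\<^sub>0} (\<lambda>\<phi>. edge_point v w (\<phi> / \<theta>\<^sub>0) i)" for i
        by (cases "i = w"; cases "i = v")
           (use angle_pos in \<open>auto simp: edge_point_def intro!: continuous_intros\<close>)
    qed
    then have g_cont: "continuous_on {0..\<theta>\<^sub>0} g"
      unfolding g_def by (rule continuous_on_compose2[OF cont]) (use in_space in auto)
    have "harmonic_on (\<lambda>z. f (face_polar V E \<theta> v w (cmod z) (Arg z))) (interior (sector \<theta>\<^sub>0))"
      using harm[unfolded cone_harmonic_def, rule_format, OF e] unfolding angle[OF e] .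
    moreover have "f (face_polar V E \<theta> v w (cmod (rcis r \<phi>)) (Arg (rcis r \<phi>))) = g \<phi> * r powr \<alpha>"
      if "0 < r" "0 < \<phi>" "\<phi> < \<theta>\<^sub>0" for r \<phi>
      using that angle_less_pi in_space[of \<phi>] angle[OF e]
      by (simp add: Arg_rcis face_polar_def \<rho> g_def)
    ultimately obtain g1 where
      "\<And>\<phi>. \<phi> \<in> {0<..<\<theta>\<^sub>0} \<Longrightarrow> (g has_real_derivative g1 \<phi>) (at \<phi>)"
      "\<And>\<phi>. \<phi> \<in> {0<..<\<theta>\<^sub>0} \<Longrightarrow> (g1 has_real_derivative - \<alpha>\<^sup>2 * g \<phi>) (at \<phi>)"
      using homogeneous_harmonic_angular[OF _ rcis_in_interior_sector[OF angle_less_pi]] by blast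
    then obtain A B where AB: "\<And>\<phi>. \<phi> \<in> {0..\<theta>\<^sub>0} \<Longrightarrow> g \<phi> = A * cos (\<alpha> * \<phi>) + B * sin (\<alpha> * \<phi>)"
      using oscillator_solution[OF _ angle_pos g_cont] degree_pos by (metis less_irrefl)
    have "edge_point v w 0 = (\<lambda>_. 0)(v := 1)" "edge_point v w 1 = (\<lambda>_. 0)(w := 1)"
      using vw by (auto simp: edge_point_def fun_eq_iff)
    then have "h v = g 0" "h w = g \<theta>\<^sub>0"
      using angle_pos by (simp_all add: h_def g_def)
    \<comment> \<open>The endpoint values determine \<open>A\<close> and then, as the sine is
      nonzero, \<open>B\<close>.\<close>
    then have hvw: "h v = A" "h w = A * cos (\<alpha> * \<theta>\<^sub>0) + B * sin (\<alpha> * \<theta>\<^sub>0)"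
      using AB angle_pos by simp_all
    have \<phi>: "x * \<theta>\<^sub>0 \<in> {0..\<theta>\<^sub>0}" and x': "x = x * \<theta>\<^sub>0 / \<theta>\<^sub>0"
      using x angle_pos by (simp_all add: mult_left_le_one_le)
    have "\<rho> p = g (x * \<theta>\<^sub>0)" using p x' by (simp add: g_def)
    also have "\<dots> = interpolate h (edge_point v w (x * \<theta>\<^sub>0 / \<theta>\<^sub>0))"
      unfolding interpolate_edge_point[OF e] AB[OF \<phi>] hvw right_diff_distrib sin_diff
      using sin_nonzero by (simp add: field_simps)
    also have "\<dots> = interpolate h p" using p x' by simp
    finally show ?thesis .
  qed
  then have "cone_extension f h" by (simp add: cone_extension_def \<rho>)
  then show thesis by (rule that)
qed

text \<open>Every homogeneous harmonic function extends some \<open>h\<close>, and every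
  \<open>h\<close> has such an extension, so balancing and nonvanishing can be tested on
  \<open>h\<close>.\<close>

lemma balanced_homogeneous_harmonic_iff:
  "(\<exists>f. cone_homogeneous V E \<alpha> f \<and> cone_harmonic V E \<theta> f \<and> cone_balanced V E \<theta> f \<and>
      (\<exists>z\<in>graph_cone V E. f z \<noteq> 0))
    \<longleftrightarrow> (\<exists>h. (\<exists>v\<in>V. h v \<noteq> 0) \<and>
      (\<forall>v\<in>V. (\<Sum>w | {v, w} \<in> E. h w) = vertex_degree E v * cos (\<alpha> * \<theta>\<^sub>0) * h v))"
  (is "?L \<longleftrightarrow> ?R")
proof
  assume ?L
  then obtain f where f: "cone_homogeneous V E \<alpha> f" "cone_harmonic V E \<theta> f"
    "cone_balanced V E \<theta> f" "\<exists>z\<in>graph_cone V E. f z \<noteq> 0" by blast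
  obtain h where h: "cone_extension f h"
    using homogeneous_harmonic_imp_cone_extension[OF f(1,2)] by blast
  show ?R
    using f(3,4) unfolding cone_extension_balanced_iff[OF h] cone_extension_nonzero_iff[OF h] by blast
next
  assume ?R
  then obtain h where h: "\<exists>v\<in>V. h v \<noteq> 0"
    "\<forall>v\<in>V. (\<Sum>w | {v, w} \<in> E. h w) = vertex_degree E v * cos (\<alpha> * \<theta>\<^sub>0) * h v" by blast
  obtain f where f: "cone_extension f h" using cone_extension_exists by blast
  show ?L
    using h cone_extension_homogeneous[OF f] cone_extension_harmonic[OF f]
    unfolding cone_extension_balanced_iff[OF f, symmetric] cone_extension_nonzero_iff[OF f, symmetric]
    by blast
qed

end

theorem proposition3p1:
  fixes V :: "'v set" and E :: "'v set set" and vs :: "'v list"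
    and \<theta> :: "'v set \<Rightarrow> real" and \<theta>\<^sub>0 \<alpha> :: real
  assumes "finite_simple_graph V E" and "connected_graph V E" and "E \<noteq> {}"
    and "distinct vs" and "set vs = V"
    and "0 < \<theta>\<^sub>0" and "\<theta>\<^sub>0 < pi" and "\<And>e. e \<in> E \<Longrightarrow> \<theta> e = \<theta>\<^sub>0"
    and "0 < \<alpha>" and "\<And>k::int. \<alpha> * \<theta>\<^sub>0 \<noteq> pi * of_int k"
  shows "(\<exists>f. cone_homogeneous V E \<alpha> f \<and> cone_harmonic V E \<theta> f \<and> cone_balanced V E \<theta> f \<and>
            (\<exists>z\<in>graph_cone V E. f z \<noteq> 0))
         \<longleftrightarrow> eigenvalue (normalized_laplacian E vs) (1 - cos (\<alpha> * \<theta>\<^sub>0))"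
proof -
  have neighbour: "\<exists>w. {v, w} \<in> E" if "v \<in> V" for v
    using connected_graph_obtain_neighbour[OF assms(1-3) that] by blast
  have "sin (\<alpha> * \<theta>\<^sub>0) \<noteq> 0"
    using assms(10) by (auto simp: sin_zero_iff_int2 mult.commute)
  then interpret equiangular_cone V E \<theta> \<theta>\<^sub>0 \<alpha>
    using assms neighbour by unfold_locales auto
  have "vertex_degree E v > 0" if "v \<in> V" for v
    using neighbour[OF that] finite_neighbours[OF assms(1), of v]
    by (auto simp: vertex_degree_eq_card_neighbours[OF assms(1)] card_gt_0_iff)
  then show ?thesis
    unfolding balanced_homogeneous_harmonic_iff
    using eigenvalue_normalized_laplacian_iff[OF assms(1,4,5)] by blast
qed

end
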